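(* For every integer $k\ge 2$ and each choice of sign, at the point $q=\pm 1/k$ each of the two Rogers–Ramanujan $q$-series $$1+\sum_{n=1}^\infty \frac{q^{n^2}}{(1-q)(1-q^2)\cdots(1-q^n)}$$ and $$1+\sum_{n=1}^\infty \frac{q^{n(n+1)}}{(1-q)(1-q^2)\cdots(1-q^n)}$$ converges to an irrational number. *)

theory Defs
  imports "HOL-Analysis.Analysis"
begin

definition rr_term1 :: "real \<Rightarrow> nat \<Rightarrow> real" where
  "rr_term1 q n = q ^ (n ^ 2) / (\<Prod>j = 1..n. 1 - q ^ j)"

definition rr_term2 :: "real \<Rightarrow> nat \<Rightarrow> real" where
  "rr_term2 q n = q ^ (n * (n + 1)) / (\<Prod>j = 1..n. 1 - q ^ j)"

end

theory Submission
  imports Defs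
begin

text \<open>
  Put \<open>p = 1/q\<close>, an integer with \<open>\<bar>p\<bar> \<ge> 2\<close>. The quotients of consecutive terms of the two
  series are \<open>1 / (p^n (p^(n+1) - 1))\<close> and \<open>1 / (p^(n+1) (p^(n+1) - 1))\<close>, so both series have
  the shape \<open>\<Sum>n. 1 / (a\<^sub>0 a\<^sub>1 \<cdots> a\<^sub>n\<^sub>-\<^sub>1)\<close> with nonzero integers \<open>a\<^sub>i\<close> whose absolute values
  tend to infinity. Every such sum is irrational (\<open>cantor_series_irrational\<close>): if \<open>v > 0\<close> is a
  denominator of the sum, then \<open>v\<close> times the tail starting at index \<open>N + 1\<close>, multiplied by
  \<open>a\<^sub>0 \<cdots> a\<^sub>N\<^sub>-\<^sub>1\<close>, is an integer, and it is smaller than \<open>1\<close> in absolute value once \<open>N\<close> is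
  large. So all late tails vanish. But the difference of two consecutive tails is a term of the
  series, which is not \<open>0\<close>.
\<close>

text \<open>
  The relation \<open>t n = a n * t (n + 1)\<close> together with \<open>t 0 = 1\<close> says that \<open>t n\<close> is the reciprocal
  of \<open>a 0 * \<dots> * a (n - 1)\<close>; in particular no \<open>a n\<close> is \<open>0\<close>.
\<close>

lemma cantor_series_irrational:
  fixes t :: "nat \<Rightarrow> real" and a :: "nat \<Rightarrow> int"
  assumes t0: "t 0 = 1"
    and rec: "\<And>n. t n = of_int (a n) * t (Suc n)"
    and lim: "filterlim (\<lambda>n. \<bar>a n\<bar>) at_top sequentially"
  shows "summable t" and "suminf t \<notin> \<rat>"
proof -
  define D where "D n = (\<Prod>i<n. a i)" for n
  have Dt: "of_int (D n) * t n = 1" for n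
  proof (induction n)
    case 0
    then show ?case by (simp add: D_def t0)
  next
    case (Suc n)
    then show ?case using rec[of n] by (simp add: D_def mult.assoc)
  qed
  have tnz: "t n \<noteq> 0" for n
    using Dt[of n] by auto
  have ex: "\<exists>N. \<forall>n\<ge>N. M \<le> \<bar>a n\<bar>" for M
    using lim by (auto simp: filterlim_at_top eventually_sequentially)
  have step: "\<bar>t (Suc n)\<bar> \<le> 1 / of_int M * \<bar>t n\<bar>" if "M > 0" "M \<le> \<bar>a n\<bar>" for n M
  proof -
    have "of_int M * \<bar>t (Suc n)\<bar> \<le> of_int \<bar>a n\<bar> * \<bar>t (Suc n)\<bar>"
      using that by (intro mult_right_mono) (simp_all only: of_int_le_iff abs_ge_zero)
    also have "\<dots> = \<bar>t n\<bar>"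
      by (subst (2) rec) (simp add: abs_mult)
    finally show ?thesis
      using that by (simp add: field_simps)
  qed
  obtain N2 where N2: "\<forall>n\<ge>N2. 2 \<le> \<bar>a n\<bar>"
    using ex by blast
  show sm: "summable t"
    by (rule summable_ratio_test[where c = "1/2" and N = N2]) (use N2 step[of 2] in auto)
  have smN: "summable (\<lambda>n. t (n + N))" for N
    using sm by (simp add: summable_iff_shift)
  define T where "T N = (\<Sum>n. t (n + N))" for N
  have T_Suc: "T N = t N + T (Suc N)" for N
    using suminf_split_head[OF smN[of N]] by (simp add: T_def)
  show "suminf t \<notin> \<rat>"
  proof
    assume "suminf t \<in> \<rat>"
    then obtain u v :: int where v: "v > 0" and uv: "suminf t = of_int u / of_int v"
      by (auto elim: Rats_cases')
    have int: "\<exists>z::int. of_int v * of_int (D N) * T N = of_int z" for N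
    proof (induction N)
      case 0
      show ?case
        using v by (intro exI[of _ u]) (simp add: D_def T_def uv)
    next
      case (Suc N)
      then obtain z :: int where z: "of_int v * of_int (D N) * T N = of_int z"
        by blast
      have "of_int v * of_int (D (Suc N)) * T (Suc N)
          = of_int (a N) * (of_int v * of_int (D N) * T N - of_int v * (of_int (D N) * t N))"
        by (simp add: D_def T_Suc[of N] algebra_simps)
      also have "\<dots> = of_int (a N * (z - v))"
        by (simp add: z Dt)
      finally show ?case by blast
    qed
    \<comment> \<open>Beyond the index \<open>K\<close> the terms shrink at least by the factor \<open>v + 2\<close>, so a tail
      is at most \<open>1 / (v + 1)\<close> times the term before it.\<close>
    obtain K where K: "\<forall>n\<ge>K. v + 2 \<le> \<bar>a n\<bar>"
      using ex by blast
    define c :: real where "c = 1 / of_int (v + 2)"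
    have c: "0 < c" "c < 1"
      using v by (simp_all add: c_def field_simps)
    have T0: "T (Suc N) = 0" if N: "N \<ge> K" for N
    proof -
      have geo: "\<bar>t (n + N)\<bar> \<le> c ^ n * \<bar>t N\<bar>" for n
      proof (induction n)
        case (Suc n)
        have "\<bar>t (Suc (n + N))\<bar> \<le> c * \<bar>t (n + N)\<bar>"
          unfolding c_def by (rule step) (use v K N in auto)
        also have "\<dots> \<le> c * (c ^ n * \<bar>t N\<bar>)"
          using Suc c by (intro mult_left_mono) auto
        finally show ?case by simp
      qed simp
      have gs: "(\<lambda>n. c ^ Suc n * \<bar>t N\<bar>) sums (c / (1 - c) * \<bar>t N\<bar>)"
        using sums_mult[OF geometric_sums[of c], of "c * \<bar>t N\<bar>"] c by (simp add: mult_ac)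
      have "\<bar>T (Suc N)\<bar> \<le> (\<Sum>n. c ^ Suc n * \<bar>t N\<bar>)"
        unfolding T_def real_norm_def[symmetric]
        using gs geo[of "Suc _"] by (intro norm_suminf_le) (auto simp: sums_iff)
      also have "\<dots> = c / (1 - c) * \<bar>t N\<bar>"
        using gs by (simp add: sums_iff)
      also have "c / (1 - c) = 1 / of_int (v + 1)"
        using v by (simp add: c_def field_simps)
      finally have le: "\<bar>T (Suc N)\<bar> \<le> 1 / of_int (v + 1) * \<bar>t N\<bar>" .
      obtain z :: int where z: "of_int v * of_int (D N) * T N = of_int z"
        using int by blast
      have zv: "of_int (z - v) = of_int v * of_int (D N) * T (Suc N)"
        using z Dt[of N] by (simp add: T_Suc[of N] algebra_simps)
      have "\<bar>of_int (z - v)\<bar> = of_int v * \<bar>of_int (D N)\<bar> * \<bar>T (Suc N)\<bar>"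
        unfolding zv using v by (simp add: abs_mult)
      also have "\<dots> \<le> of_int v * \<bar>of_int (D N)\<bar> * (1 / of_int (v + 1) * \<bar>t N\<bar>)"
        using v by (intro mult_left_mono le) auto
      also have "\<dots> = of_int v / of_int (v + 1) * \<bar>of_int (D N) * t N\<bar>"
        by (simp add: abs_mult)
      also have "\<dots> < (1::real)"
        using v by (simp add: Dt)
      finally have "\<bar>z - v\<bar> < 1"
        by linarith
      then have "of_int v * of_int (D N) * T (Suc N) = 0"
        using zv by simp
      moreover have "D N \<noteq> 0"
        using Dt[of N] by auto
      ultimately show ?thesis
        using v by simp
    qed
    have "t (Suc K) = 0"
      using T_Suc[of "Suc K"] T0[of K] T0[of "Suc K"] by simp
    with tnz show False by blast
  qed
qed

lemma power_diff_one_ge: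
  fixes p :: int
  assumes "\<bar>p\<bar> \<ge> 2"
  shows "int (Suc n) \<le> \<bar>p ^ Suc n - 1\<bar>"
proof -
  have "int (Suc n) + 1 \<le> 2 ^ Suc n"
    by (induction n) auto
  also have "\<dots> \<le> \<bar>p\<bar> ^ Suc n"
    using assms by (intro power_mono) auto
  also have "\<dots> = \<bar>p ^ Suc n\<bar>"
    by (simp only: power_abs)
  finally show ?thesis by linarith
qed

lemma filterlim_power_mult_power_diff_one:
  fixes p :: int and e :: "nat \<Rightarrow> nat"
  assumes "\<bar>p\<bar> \<ge> 2"
  shows "filterlim (\<lambda>n. \<bar>p ^ e n * (p ^ Suc n - 1)\<bar>) at_top sequentially"
proof (rule filterlim_at_top_mono[OF filterlim_int_sequentially])
  have "int n \<le> \<bar>p ^ e n * (p ^ Suc n - 1)\<bar>" for n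
  proof -
    have "int n \<le> 1 * \<bar>p ^ Suc n - 1\<bar>"
      using power_diff_one_ge[OF assms, of n] by simp
    also have "\<dots> \<le> \<bar>p ^ e n\<bar> * \<bar>p ^ Suc n - 1\<bar>"
      using assms by (intro mult_right_mono) (auto simp: power_abs)
    finally show ?thesis by (simp only: abs_mult)
  qed
  then show "eventually (\<lambda>n. int n \<le> \<bar>p ^ e n * (p ^ Suc n - 1)\<bar>) sequentially"
    by simp
qed

context
  fixes p :: int and q :: real
  assumes p: "\<bar>p\<bar> \<ge> 2" and q: "q = 1 / of_int p"
begin

lemma one_minus_power_q_nonzero: "1 - q ^ Suc n \<noteq> 0"
proof -
  have "0 < \<bar>q\<bar>" "\<bar>q\<bar> < 1"
    using p by (auto simp: q)
  then have "\<bar>q ^ Suc n\<bar> < 1"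
    unfolding power_abs by (intro power_Suc_less_one) auto
  then show ?thesis by auto
qed

lemma power_p_mult_power_q: "of_int p ^ n * q ^ n = 1"
proof -
  have "of_int p * q = 1"
    using p by (auto simp: q)
  then show ?thesis
    by (simp flip: power_mult_distrib)
qed

lemma power_diff_one_mult_power_q: "(of_int p ^ n - 1) * q ^ n = 1 - q ^ n"
  by (simp add: left_diff_distrib power_p_mult_power_q)

lemma rr_term1_rec:
  "rr_term1 q n = of_int (p ^ n * (p ^ Suc n - 1)) * rr_term1 q (Suc n)"
proof -
  define P where "P = (\<Prod>j = 1..n. 1 - q ^ j)"
  have "Suc n ^ 2 = n ^ 2 + n + Suc n"
    by (simp add: power2_eq_square)
  then have "of_int (p ^ n * (p ^ Suc n - 1)) * q ^ (Suc n ^ 2)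
      = q ^ (n ^ 2) * (of_int p ^ n * q ^ n) * ((of_int p ^ Suc n - 1) * q ^ Suc n)"
    by (simp only: power_add of_int_mult of_int_diff of_int_power of_int_1 mult_ac)
  also have "\<dots> = q ^ (n ^ 2) * (1 - q ^ Suc n)"
    by (simp only: power_p_mult_power_q power_diff_one_mult_power_q mult_1_right)
  finally have "of_int (p ^ n * (p ^ Suc n - 1)) * rr_term1 q (Suc n)
      = q ^ (n ^ 2) * (1 - q ^ Suc n) / (P * (1 - q ^ Suc n))"
    unfolding rr_term1_def P_def by (simp only: times_divide_eq_right prod.cl_ivl_Suc) simp
  also have "\<dots> = rr_term1 q n"
    using one_minus_power_q_nonzero[of n] by (simp only: rr_term1_def P_def) simp
  finally show ?thesis ..
qed

lemma rr_term2_rec: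
  "rr_term2 q n = of_int (p ^ Suc n * (p ^ Suc n - 1)) * rr_term2 q (Suc n)"
proof -
  define P where "P = (\<Prod>j = 1..n. 1 - q ^ j)"
  have "Suc n * (Suc n + 1) = n * (n + 1) + Suc n + Suc n"
    by simp
  then have "of_int (p ^ Suc n * (p ^ Suc n - 1)) * q ^ (Suc n * (Suc n + 1))
      = q ^ (n * (n + 1)) * (of_int p ^ Suc n * q ^ Suc n) * ((of_int p ^ Suc n - 1) * q ^ Suc n)"
    by (simp only: power_add of_int_mult of_int_diff of_int_power of_int_1 mult_ac)
  also have "\<dots> = q ^ (n * (n + 1)) * (1 - q ^ Suc n)"
    by (simp only: power_p_mult_power_q power_diff_one_mult_power_q mult_1_right)
  finally have "of_int (p ^ Suc n * (p ^ Suc n - 1)) * rr_term2 q (Suc n)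
      = q ^ (n * (n + 1)) * (1 - q ^ Suc n) / (P * (1 - q ^ Suc n))"
    unfolding rr_term2_def P_def by (simp only: times_divide_eq_right prod.cl_ivl_Suc) simp
  also have "\<dots> = rr_term2 q n"
    using one_minus_power_q_nonzero[of n] by (simp only: rr_term2_def P_def) simp
  finally show ?thesis ..
qed

end

theorem theorem2p2:
  fixes k :: int and q :: real
  assumes "k \<ge> 2"
    and "q = 1 / of_int k \<or> q = - 1 / of_int k"
  shows "summable (\<lambda>n. rr_term1 q (Suc n)) \<and> 1 + (\<Sum>n. rr_term1 q (Suc n)) \<notin> \<rat> \<and>
         summable (\<lambda>n. rr_term2 q (Suc n)) \<and> 1 + (\<Sum>n. rr_term2 q (Suc n)) \<notin> \<rat>"
proof -
  obtain p :: int where p: "\<bar>p\<bar> \<ge> 2" and q: "q = 1 / of_int p"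
  proof (cases "q = 1 / of_int k")
    case True
    then show ?thesis using assms(1) by (intro that[of k]) auto
  next
    case False
    then show ?thesis using assms by (intro that[of "- k"]) auto
  qed
  have init: "rr_term1 q 0 = 1" "rr_term2 q 0 = 1"
    by (simp_all add: rr_term1_def rr_term2_def)
  note series1 = cantor_series_irrational[where t = "rr_term1 q", OF init(1) rr_term1_rec[OF p q]
      filterlim_power_mult_power_diff_one[OF p]]
  note series2 = cantor_series_irrational[where t = "rr_term2 q", OF init(2) rr_term2_rec[OF p q]
      filterlim_power_mult_power_diff_one[OF p]]
  show ?thesis
    using series1 series2 suminf_split_head[OF series1(1)] suminf_split_head[OF series2(1)]
    by (simp add: init summable_Suc_iff)
qed

end
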